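(* Let $I=(S,T,C,\alpha)$ be an instance of FLaMECaST and let $L$ be a valid layout of minimum cost for $I$. Let $a$ and $b$ be two sources with different positions, and let $v_a$ and $v_b$ be their respective parents in $L$. If $v_a\neq v_b$ and the points $a,b,v_a,v_b$ are not collinear, then the edges (straight segments) $av_a$ and $bv_b$ do not intersect.
   Context: FLaMECaST: an instance $I=(S,T,C,\alpha)$ consists of a finite set $S$ of sources and a finite set $T$ of sinks, each with a fixed position in $\mathbb{R}^2$ (several sources may share a position), capacities $C=(c_0,\dots,c_{\lambda+1})$ with integers $c_0\ge c_1\ge\dots\ge c_{\lambda+1}\ge 1$ ($\lambda\ge 0$ is the number of intermediate layers), and a parameter $\alpha\in[0,1]$. A topology is a rooted forest (edges directed from child to parent) of height at most $\lambda+1$ whose leaves are exactly $S$ and whose roots form a subset of $T$; its other vertices are Steiner vertices. The layer of a vertex is the number of edges on its path to its root. The load $\ell(v)$ of a vertex is the number of sources in its subtree; the load of an edge $uv$ ($u$ child of $v$) is $\ell(u)$. A topology is valid if $\ell(v)\le c_i$ for every vertex $v$ in layer $i$. An embedding maps each vertex to a point of $\mathbb{R}^2$, sources and sinks to their given positions and Steiner vertices arbitrarily; a topology with an embedding is a layout (valid if its topology is valid). The cost of an edge $uv$ is $\|\mathrm{pos}(u)-\mathrm{pos}(v)\|\cdot\ell(uv)^\alpha$ and the cost of a layout is the sum of its edge costs.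
   Formalization: The condition v_a ≠ v_b is taken to mean that the parents have different positions, not merely that they are different vertices; two distinct parents embedded at the same point would make the closed segments share that endpoint, so the literal claim fails there. *)

theory Defs
  imports "HOL-Analysis.Analysis"
begin

(* Steiner vertices are drawn from a countably infinite supply, so up to renaming every finite
   topology is represented, and a minimum over layouts is a minimum over all of them. *)
datatype ('s, 't) vertex = Source 's | Sink 't | Steiner nat

(* caps is the list [c_0, ..., c_(lambda+1)]. *)
record ('s, 't) flamecast =
  sources :: "'s set"
  sinks :: "'t set"
  source_pos :: "'s \<Rightarrow> real^2"
  sink_pos :: "'t \<Rightarrow> real^2"
  caps :: "nat list"
  alpha :: real

definition num_layers :: "('s, 't) flamecast \<Rightarrow> nat" where
  "num_layers I = length (caps I) - 2"

definition flamecast_instance :: "('s, 't) flamecast \<Rightarrow> bool" where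
  "flamecast_instance I \<longleftrightarrow>
     finite (sources I) \<and> finite (sinks I) \<and>
     length (caps I) \<ge> 2 \<and> sorted_wrt (\<ge>) (caps I) \<and> (\<forall>c\<in>set (caps I). c \<ge> 1) \<and>
     0 \<le> alpha I \<and> alpha I \<le> 1"

(* A pair (u, v) in edges is directed from the child u to the parent v. *)
record ('s, 't) forest =
  verts :: "('s, 't) vertex set"
  edges :: "(('s, 't) vertex \<times> ('s, 't) vertex) set"

definition rooted_forest :: "('s, 't) forest \<Rightarrow> bool" where
  "rooted_forest F \<longleftrightarrow>
     finite (verts F) \<and> edges F \<subseteq> verts F \<times> verts F \<and> single_valued (edges F) \<and> acyclic (edges F)"

definition roots :: "('s, 't) forest \<Rightarrow> ('s, 't) vertex set" where
  "roots F = {v \<in> verts F. \<nexists>u. (v, u) \<in> edges F}"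

definition leaves :: "('s, 't) forest \<Rightarrow> ('s, 't) vertex set" where
  "leaves F = {v \<in> verts F. \<nexists>u. (u, v) \<in> edges F}"

definition layer :: "('s, 't) forest \<Rightarrow> ('s, 't) vertex \<Rightarrow> nat" where
  "layer F v = (THE n. \<exists>r\<in>roots F. (v, r) \<in> edges F ^^ n)"

definition subtree :: "('s, 't) forest \<Rightarrow> ('s, 't) vertex \<Rightarrow> ('s, 't) vertex set" where
  "subtree F v = {u \<in> verts F. (u, v) \<in> (edges F)\<^sup>*}"

definition load :: "('s, 't) forest \<Rightarrow> ('s, 't) vertex \<Rightarrow> nat" where
  "load F v = card {s. Source s \<in> subtree F v}"

(* The last conjunct also says that a sink occurs in the forest only as a root. *)
definition topology :: "('s, 't) flamecast \<Rightarrow> ('s, 't) forest \<Rightarrow> bool" where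
  "topology I F \<longleftrightarrow>
     rooted_forest F \<and>
     (\<forall>v\<in>verts F. layer F v \<le> num_layers I + 1) \<and>
     leaves F = Source ` sources I \<and>
     roots F \<subseteq> Sink ` sinks I \<and>
     verts F - (leaves F \<union> roots F) \<subseteq> range Steiner"

definition valid_topology :: "('s, 't) flamecast \<Rightarrow> ('s, 't) forest \<Rightarrow> bool" where
  "valid_topology I F \<longleftrightarrow> topology I F \<and> (\<forall>v\<in>verts F. load F v \<le> caps I ! layer F v)"

(* The values of pos outside the vertices of the topology are irrelevant. *)
record ('s, 't) layout =
  topo :: "('s, 't) forest"
  pos :: "('s, 't) vertex \<Rightarrow> real^2"

definition embedding :: "('s, 't) flamecast \<Rightarrow> ('s, 't) layout \<Rightarrow> bool" where
  "embedding I L \<longleftrightarrow>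
     (\<forall>s. Source s \<in> verts (topo L) \<longrightarrow> pos L (Source s) = source_pos I s) \<and>
     (\<forall>t. Sink t \<in> verts (topo L) \<longrightarrow> pos L (Sink t) = sink_pos I t)"

definition valid_layout :: "('s, 't) flamecast \<Rightarrow> ('s, 't) layout \<Rightarrow> bool" where
  "valid_layout I L \<longleftrightarrow> valid_topology I (topo L) \<and> embedding I L"

definition cost :: "('s, 't) flamecast \<Rightarrow> ('s, 't) layout \<Rightarrow> real" where
  "cost I L =
     (\<Sum>(u, v)\<in>edges (topo L). norm (pos L u - pos L v) * real (load (topo L) u) powr alpha I)"

end

theory Submission imports Defs begin

text \<open>Suppose the two edges meet in a point \<open>p\<close>. Exchanging the sources \<open>a\<close> and \<open>b\<close> in the topology
  keeps it valid, and replaces the edges \<open>a v\<^sub>a\<close>, \<open>b v\<^sub>b\<close> of load 1 by \<open>a v\<^sub>b\<close>, \<open>b v\<^sub>a\<close>, which by the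
  triangle inequality through \<open>p\<close> are not longer in total. By minimality equality holds, so \<open>p\<close> also
  lies on the segments \<open>a v\<^sub>b\<close> and \<open>b v\<^sub>a\<close>, which forces the four points onto a line. As sources are
  leaves, the exchange is the relabelling of the forest by the transposition of \<open>a\<close> and \<open>b\<close>; hence
  layers and loads are simply transported along it.\<close>

section \<open>Renaming the sources of a forest\<close>

text \<open>\<open>map_vertex \<sigma> id\<close> fixes sinks and Steiner vertices. Positions are
  kept apart from the forest, so a layout can be relabelled while its \<open>pos\<close> stays the
  same.\<close>

definition relabel :: "('s \<Rightarrow> 's) \<Rightarrow> ('s, 't) forest \<Rightarrow> ('s, 't) forest" where
  "relabel \<sigma> F =
     \<lparr>verts = map_vertex \<sigma> id ` verts F,
      edges = map_prod (map_vertex \<sigma> id) (map_vertex \<sigma> id) ` edges F\<rparr>"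

lemma bij_map_vertex:
  assumes "bij \<sigma>"
  shows "bij (map_vertex \<sigma> id :: ('s, 't) vertex \<Rightarrow> ('s, 't) vertex)"
proof (rule o_bij)
  show "map_vertex (inv \<sigma>) id \<circ> map_vertex \<sigma> id = (id :: ('s, 't) vertex \<Rightarrow> _)"
    using assms by (simp add: fun_eq_iff vertex.map_comp bij_is_inj vertex.map_id)
  show "map_vertex \<sigma> id \<circ> map_vertex (inv \<sigma>) id = (id :: ('s, 't) vertex \<Rightarrow> _)"
    using assms by (simp add: fun_eq_iff vertex.map_comp bij_is_surj surj_iff[THEN iffD1]
        vertex.map_id)
qed

lemma map_prod_image_iff:
  assumes "inj f"
  shows "(f u, f v) \<in> map_prod f f ` E \<longleftrightarrow> (u, v) \<in> E"
  using assms by (auto simp: inj_eq intro: rev_image_eqI)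

text \<open>Layers, subtrees and acyclicity can all be expressed by powers of the edge relation, so
  this equivalence serves to transport all three.\<close>

lemma relpow_map_prod_iff:
  assumes "bij f"
  shows "(f u, f v) \<in> (map_prod f f ` E) ^^ n \<longleftrightarrow> (u, v) \<in> E ^^ n"
proof (induction n arbitrary: v)
  case 0
  show ?case using assms by (auto dest: bij_is_inj injD)
next
  case (Suc n)
  have "(f u, f v) \<in> (map_prod f f ` E) ^^ Suc n \<longleftrightarrow>
      (\<exists>w. (f u, w) \<in> (map_prod f f ` E) ^^ n \<and> (w, f v) \<in> map_prod f f ` E)"
    by (simp only: relpow.simps(2) relcomp_unfold mem_Collect_eq case_prod_conv)
  \<comment> \<open>Surjectivity lets the intermediate vertex be written as an image, so that the
    induction hypothesis applies to it.\<close>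
  also have "\<dots> \<longleftrightarrow>
      (\<exists>w. (f u, f w) \<in> (map_prod f f ` E) ^^ n \<and> (f w, f v) \<in> map_prod f f ` E)"
    using bij_is_surj[OF assms] by (metis surjD)
  also have "\<dots> \<longleftrightarrow> (u, v) \<in> E ^^ Suc n"
    by (simp only: Suc.IH map_prod_image_iff[OF bij_is_inj[OF assms]] relpow.simps(2))
      (auto simp: relcomp_unfold)
  finally show ?case .
qed

context
  fixes \<sigma> :: "'s \<Rightarrow> 's"
  assumes bij: "bij \<sigma>"
begin

lemma relabel_edge_iff:
  "(map_vertex \<sigma> id u, map_vertex \<sigma> id v) \<in> edges (relabel \<sigma> F) \<longleftrightarrow> (u, v) \<in> edges F"
  unfolding relabel_def by (simp add: map_prod_image_iff[OF bij_is_inj[OF bij_map_vertex[OF bij]]])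

lemma relabel_vert_iff: "map_vertex \<sigma> id v \<in> verts (relabel \<sigma> F) \<longleftrightarrow> v \<in> verts F"
  unfolding relabel_def by (simp add: inj_image_mem_iff[OF bij_is_inj[OF bij_map_vertex[OF bij]]])

lemma relabel_relpow_iff:
  "(map_vertex \<sigma> id u, map_vertex \<sigma> id v) \<in> edges (relabel \<sigma> F) ^^ n \<longleftrightarrow> (u, v) \<in> edges F ^^ n"
  unfolding relabel_def by (simp add: relpow_map_prod_iff[OF bij_map_vertex[OF bij]])

lemma map_vertex_cases:
  obtains v where "u = map_vertex \<sigma> id v"
  using surjD[OF bij_is_surj[OF bij_map_vertex[OF bij]]] by blast

lemma mem_image_map_vertex_iff: "map_vertex \<sigma> id v \<in> map_vertex \<sigma> id ` A \<longleftrightarrow> v \<in> A"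
  by (rule inj_image_mem_iff[OF bij_is_inj[OF bij_map_vertex[OF bij]]])

lemma ex_map_vertex_iff: "(\<exists>u. P u) \<longleftrightarrow> (\<exists>v. P (map_vertex \<sigma> id v))"
proof
  assume "\<exists>u. P u"
  then obtain u where "P u" by blast
  moreover obtain v where "u = map_vertex \<sigma> id v" by (rule map_vertex_cases)
  ultimately show "\<exists>v. P (map_vertex \<sigma> id v)" by blast
qed blast

text \<open>Every vertex is an image, so membership has to be tested on images only, where the
  equivalences above rewrite it.\<close>

lemma map_vertex_set_eqI:
  fixes A B :: "('s, 't) vertex set"
  assumes "\<And>v. map_vertex \<sigma> id v \<in> A \<longleftrightarrow> v \<in> B"
  shows "A = map_vertex \<sigma> id ` B"
proof (rule set_eqI)
  fix u :: "('s, 't) vertex"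
  obtain v where "u = map_vertex \<sigma> id v" by (rule map_vertex_cases)
  then show "u \<in> A \<longleftrightarrow> u \<in> map_vertex \<sigma> id ` B"
    by (simp add: assms mem_image_map_vertex_iff)
qed

lemma roots_relabel: "roots (relabel \<sigma> F) = map_vertex \<sigma> id ` roots F"
  by (rule map_vertex_set_eqI)
    (simp add: roots_def relabel_vert_iff ex_map_vertex_iff[of "\<lambda>u. (_, u) \<in> edges (relabel \<sigma> F)"]
      relabel_edge_iff)

lemma leaves_relabel: "leaves (relabel \<sigma> F) = map_vertex \<sigma> id ` leaves F"
  by (rule map_vertex_set_eqI)
    (simp add: leaves_def relabel_vert_iff ex_map_vertex_iff[of "\<lambda>u. (u, _) \<in> edges (relabel \<sigma> F)"]
      relabel_edge_iff)

text \<open>Roots and paths correspond, so both sides apply \<open>THE\<close> to the same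
  predicate.\<close>

lemma layer_relabel: "layer (relabel \<sigma> F) (map_vertex \<sigma> id v) = layer F v"
  by (simp add: layer_def roots_relabel relabel_relpow_iff)

lemma subtree_relabel:
  "subtree (relabel \<sigma> F) (map_vertex \<sigma> id v) = map_vertex \<sigma> id ` subtree F v"
  by (rule map_vertex_set_eqI)
    (simp add: subtree_def relabel_vert_iff rtrancl_power relabel_relpow_iff)

text \<open>The sources in the new subtree are the image under \<sigma> of those in the old one, and
  an injective map preserves cardinality.\<close>

lemma load_relabel:
  fixes F :: "('s, 't) forest"
  shows "load (relabel \<sigma> F) (map_vertex \<sigma> id v) = load F v"
proof -
  have "{s. Source s \<in> map_vertex \<sigma> id ` X} = \<sigma> ` {s. Source s \<in> X}"
    for X :: "('s, 't) vertex set"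
  proof (intro set_eqI iffI)
    fix s assume "s \<in> {s. Source s \<in> map_vertex \<sigma> id ` X}"
    then obtain x where "x \<in> X" "Source s = map_vertex \<sigma> id x" by auto
    then show "s \<in> \<sigma> ` {s. Source s \<in> X}" by (cases x) auto
  qed force
  then show ?thesis
    by (simp add: load_def subtree_relabel card_image inj_on_subset[OF bij_is_inj[OF bij]])
qed

lemma rooted_forest_relabel:
  assumes "rooted_forest F"
  shows "rooted_forest (relabel \<sigma> F)"
proof -
  have "single_valued (edges (relabel \<sigma> F))"
    using assms
    by (auto simp: rooted_forest_def relabel_def single_valued_def
        inj_eq[OF bij_is_inj[OF bij_map_vertex[OF bij]]])
  moreover have "(u, u) \<notin> (edges (relabel \<sigma> F))\<^sup>+" for u
  proof -
    obtain v where "u = map_vertex \<sigma> id v" by (rule map_vertex_cases)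
    then show ?thesis
      using assms by (simp add: rooted_forest_def acyclic_def trancl_power relabel_relpow_iff)
  qed
  ultimately show ?thesis
    using assms by (auto simp: rooted_forest_def relabel_def acyclic_def)
qed

text \<open>Since \<sigma> permutes the sources, the set of leaves stays the same; roots and Steiner
  vertices are fixed. The capacity bounds carry over with layers and loads.\<close>

lemma valid_topology_relabel:
  assumes "valid_topology I F" and "\<sigma> ` sources I = sources I"
  shows "valid_topology I (relabel \<sigma> F)"
proof -
  have verts: "verts (relabel \<sigma> F) = map_vertex \<sigma> id ` verts F"
    by (simp add: relabel_def)
  have "map_vertex \<sigma> id ` leaves F = Source ` sources I"
  proof -
    have "map_vertex \<sigma> id ` Source ` sources I = Source ` \<sigma> ` sources I"
      by (simp add: image_image)
    then show ?thesis
      using assms by (simp add: topology_def valid_topology_def)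
  qed
  moreover have "roots F \<subseteq> Sink ` sinks I"
    using assms by (simp add: topology_def valid_topology_def)
  then have "map_vertex \<sigma> id ` roots F \<subseteq> map_vertex \<sigma> id ` Sink ` sinks I"
    by (rule image_mono)
  then have "map_vertex \<sigma> id ` roots F \<subseteq> Sink ` sinks I"
    by (simp add: image_image)
  moreover have "verts F - (leaves F \<union> roots F) \<subseteq> range Steiner"
    using assms(1) unfolding topology_def valid_topology_def by (elim conjE)
  then have "map_vertex \<sigma> id ` (verts F - (leaves F \<union> roots F)) \<subseteq> map_vertex \<sigma> id ` range Steiner"
    by (rule image_mono)
  then have "map_vertex \<sigma> id ` (verts F - (leaves F \<union> roots F)) \<subseteq> range Steiner"
    by (simp add: image_image)
  then have "map_vertex \<sigma> id ` verts F - (map_vertex \<sigma> id ` leaves F \<union> map_vertex \<sigma> id ` roots F)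
      \<subseteq> range Steiner"
    by blast
  ultimately have "topology I (relabel \<sigma> F)"
    using assms
    by (simp add: valid_topology_def topology_def rooted_forest_relabel verts layer_relabel
        roots_relabel leaves_relabel)
  then show ?thesis
    using assms by (simp add: valid_topology_def verts layer_relabel load_relabel)
qed

lemma valid_layout_relabel:
  fixes I :: "('s, 't) flamecast"
  assumes "valid_layout I L" and "\<sigma> ` sources I = sources I"
  shows "valid_layout I \<lparr>topo = relabel \<sigma> (topo L), pos = pos L\<rparr>"
proof -
  \<comment> \<open>Both topologies contain exactly the sources of \<open>I\<close>, so the
    embedding condition on sources is the same for both.\<close>
  have verts_iff: "Source s \<in> verts F \<longleftrightarrow> s \<in> sources I"
    if "valid_topology I F" for s and F :: "('s, 't) forest"
  proof
    have F: "leaves F = Source ` sources I" "roots F \<subseteq> Sink ` sinks I"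
      using that by (simp_all add: valid_topology_def topology_def)
    have Steiner: "verts F - (leaves F \<union> roots F) \<subseteq> range Steiner"
      using that unfolding valid_topology_def topology_def by (elim conjE)
    show "s \<in> sources I" if "Source s \<in> verts F"
    proof -
      have "Source s \<notin> roots F" "Source s \<notin> range Steiner"
        using F(2) by auto
      then have "Source s \<in> leaves F"
        using that Steiner by blast
      then show ?thesis
        using F(1) by auto
    qed
    show "Source s \<in> verts F" if "s \<in> sources I"
      using that F(1) unfolding leaves_def by blast
  qed
  have "valid_topology I (relabel \<sigma> (topo L))"
    using assms by (simp add: valid_layout_def valid_topology_relabel)
  moreover have "Sink t \<in> verts (topo L)" if "Sink t \<in> verts (relabel \<sigma> (topo L))" for t
    using that relabel_vert_iff[of "Sink t" "topo L"] by simp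
  ultimately show ?thesis
    using assms verts_iff by (auto simp: valid_layout_def embedding_def)
qed

text \<open>Reindexing along the injective edge map pulls the sum back to \<open>F\<close>: the
  loads are the old ones and only the end points move.\<close>

lemma cost_relabel:
  "cost I \<lparr>topo = relabel \<sigma> F, pos = p\<rparr> =
   (\<Sum>(u, v)\<in>edges F. norm (p (map_vertex \<sigma> id u) - p (map_vertex \<sigma> id v))
      * real (load F u) powr alpha I)"
proof -
  have "inj_on (map_prod (map_vertex \<sigma> id) (map_vertex \<sigma> id)) (edges F)"
    by (auto simp: inj_on_def inj_eq[OF bij_is_inj[OF bij_map_vertex[OF bij]]])
  moreover have "edges (relabel \<sigma> F) =
      map_prod (map_vertex \<sigma> id) (map_vertex \<sigma> id) ` edges F"
    by (simp add: relabel_def)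
  ultimately show ?thesis
    unfolding cost_def
    by (simp add: sum.reindex case_prod_beta load_relabel)
qed

end

section \<open>Change of cost under the exchange\<close>

lemma load_leaf:
  assumes "Source s \<in> leaves F"
  shows "load F (Source s) = 1"
proof -
  have "u = Source s" if "(u, Source s) \<in> (edges F)\<^sup>*" for u
    using that assms by (auto simp: leaves_def elim: rtranclE)
  then have "{s'. Source s' \<in> subtree F (Source s)} = {s}"
    using assms by (auto simp: subtree_def leaves_def)
  then show ?thesis by (simp add: load_def)
qed

text \<open>Only the edges leaving the two sources change length. Their load is 1, so the factor
  \<open>1 powr alpha I\<close> disappears.\<close>

lemma cost_transpose_sources:
  assumes "valid_layout I L"
    and "(Source a, v\<^sub>a) \<in> edges (topo L)" and "(Source b, v\<^sub>b) \<in> edges (topo L)"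
    and "a \<in> sources I" and "b \<in> sources I" and "a \<noteq> b"
  shows "cost I \<lparr>topo = relabel (Transposition.transpose a b) (topo L), pos = pos L\<rparr> - cost I L =
    norm (pos L (Source a) - pos L v\<^sub>b) + norm (pos L (Source b) - pos L v\<^sub>a)
    - norm (pos L (Source a) - pos L v\<^sub>a) - norm (pos L (Source b) - pos L v\<^sub>b)"
proof -
  define \<tau> :: "('a, 'b) vertex \<Rightarrow> ('a, 'b) vertex"
    where "\<tau> = map_vertex (Transposition.transpose a b) id"
  let ?F = "topo L" and ?E = "edges (topo L)" and ?p = "pos L"
  have F: "rooted_forest ?F" "leaves ?F = Source ` sources I"
    using assms(1) by (auto simp: valid_layout_def valid_topology_def topology_def)
  have "finite ?E"
    using F(1) by (auto simp: rooted_forest_def intro: finite_subset)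
  have leaf: "Source a \<in> leaves ?F" "Source b \<in> leaves ?F"
    using F assms(4,5) by auto
  have \<tau>_other: "\<tau> u = u" if "u \<noteq> Source a" "u \<noteq> Source b" for u
    using that by (cases u) (auto simp: \<tau>_def Transposition.transpose_def)
  \<comment> \<open>A parent is not a leaf, hence neither of the two exchanged sources.\<close>
  have \<tau>_parent: "\<tau> v = v" if "(u, v) \<in> ?E" for u v
    using that leaf by (intro \<tau>_other) (auto simp: leaves_def)
  let ?g = "\<lambda>(u, v). (norm (?p (\<tau> u) - ?p (\<tau> v)) - norm (?p u - ?p v))
    * real (load ?F u) powr alpha I"
  have "cost I \<lparr>topo = relabel (Transposition.transpose a b) ?F, pos = ?p\<rparr> - cost I L = sum ?g ?E"
    by (subst cost_relabel)
      (simp_all add: cost_def \<tau>_def sum_subtractf[symmetric] case_prod_beta left_diff_distrib)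
  also have "\<dots> = sum ?g {(Source a, v\<^sub>a), (Source b, v\<^sub>b)}"
  proof (rule sum.mono_neutral_right)
    \<comment> \<open>Each vertex has at most one parent, so no further edge starts at an exchanged
      source.\<close>
    have "u \<noteq> Source a \<and> u \<noteq> Source b" if "(u, v) \<in> ?E - {(Source a, v\<^sub>a), (Source b, v\<^sub>b)}" for u v
      using that F(1) assms(2,3) by (auto simp: rooted_forest_def dest: single_valuedD)
    then have "\<tau> u = u \<and> \<tau> v = v" if "(u, v) \<in> ?E - {(Source a, v\<^sub>a), (Source b, v\<^sub>b)}" for u v
      using that \<tau>_other \<tau>_parent by blast
    then show "\<forall>e\<in>?E - {(Source a, v\<^sub>a), (Source b, v\<^sub>b)}. ?g e = 0"
      by (metis (no_types, lifting) case_prod_conv diff_self mult_zero_left surj_pair)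
  qed (use \<open>finite ?E\<close> assms in auto)
  also have "\<dots> = norm (?p (Source b) - ?p v\<^sub>a) - norm (?p (Source a) - ?p v\<^sub>a)
      + (norm (?p (Source a) - ?p v\<^sub>b) - norm (?p (Source b) - ?p v\<^sub>b))"
  proof -
    have "\<tau> (Source a) = Source b" "\<tau> (Source b) = Source a"
      by (simp_all add: \<tau>_def)
    then show ?thesis
      using \<open>a \<noteq> b\<close> \<tau>_parent[OF assms(2)] \<tau>_parent[OF assms(3)] leaf
      by (simp add: load_leaf)
  qed
  finally show ?thesis by simp
qed

section \<open>Geometry of crossing segments\<close>

text \<open>The line through \<open>a\<close> and \<open>p\<close> contains \<open>c\<close> and
  \<open>d\<close>; one of these differs from \<open>p\<close> and so determines the same line,
  which then contains \<open>b\<close>.\<close>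

lemma collinear_4_via_common_point:
  fixes p a b c d :: "'a::euclidean_space"
  assumes "collinear {a, p, c}" "collinear {a, p, d}" "collinear {b, p, c}" "collinear {b, p, d}"
    and "a \<noteq> p" "c \<noteq> d"
  shows "collinear {a, b, c, d}"
proof -
  have on_line: "c \<in> affine hull {a, p}" "d \<in> affine hull {a, p}"
    using assms by (simp_all add: collinear_3_affine_hull)
  have "b \<in> affine hull {a, p}"
  proof -
    \<comment> \<open>The witness \<open>e\<close> is whichever of \<open>c\<close> and
      \<open>d\<close> differs from \<open>p\<close>.\<close>
    obtain e where e: "e \<noteq> p" "e \<in> affine hull {a, p}" "collinear {p, e, b}"
      using assms on_line by (metis insert_commute)
    then have "b \<in> affine hull {p, e}"
      by (simp add: collinear_3_affine_hull)
    moreover have "affine hull {p, e} \<subseteq> affine hull {a, p}"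
      using e(2) by (intro hull_minimal) (auto simp: hull_inc)
    ultimately show ?thesis by blast
  qed
  then have "{a, b, c, d} \<subseteq> affine hull {a, p}"
    using on_line by (auto simp: hull_inc)
  then show ?thesis
    using collinear_affine_hull by blast
qed

lemma crossing_segments_exchange_less:
  fixes a b c d :: "'a::euclidean_space"
  assumes "p \<in> closed_segment a c" "p \<in> closed_segment b d"
    and "a \<noteq> b" "c \<noteq> d" "\<not> collinear {a, b, c, d}"
  shows "dist a d + dist b c < dist a c + dist b d"
proof (rule ccontr)
  assume not_less: "\<not> ?thesis"
  have "dist a c = dist a p + dist p c" "dist b d = dist b p + dist p d"
    using assms by (simp_all add: between_mem_segment[symmetric] between)
  moreover have "dist a d \<le> dist a p + dist p d" "dist b c \<le> dist b p + dist p c"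
    by (rule dist_triangle)+
  \<comment> \<open>The two upper bounds add up to \<open>dist a c + dist b d\<close>, so without
    strict decrease both are attained and \<open>p\<close> lies on all four segments.\<close>
  ultimately have "dist a d = dist a p + dist p d" "dist b c = dist b p + dist p c"
    using not_less by linarith+
  then have "between (a, d) p" "between (b, c) p" "between (a, c) p" "between (b, d) p"
    using assms by (simp_all add: between) (simp_all add: between_mem_segment[symmetric] between)
  then have col: "collinear {a, p, d}" "collinear {b, p, c}" "collinear {a, p, c}"
      "collinear {b, p, d}"
    by (auto dest: between_imp_collinear)
  show False
  \<comment> \<open>The collinearity lemma needs a point different from \<open>p\<close>; as
    \<open>a \<noteq> b\<close>, either \<open>a\<close> or \<open>b\<close> will do, and the
    collinearities are symmetric in them.\<close>
  proof (cases "a = p")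
    case False
    then show False using collinear_4_via_common_point[of a p c d b] col assms by blast
  next
    case True
    then have "collinear {b, a, c, d}"
      using collinear_4_via_common_point[of b p c d a] col assms by blast
    then show False using assms by (simp add: insert_commute)
  qed
qed

theorem lemma3:
  fixes I :: "('s, 't) flamecast"
    and L :: "('s, 't) layout"
    and a b :: 's
    and v\<^sub>a v\<^sub>b :: "('s, 't) vertex"
  assumes "flamecast_instance I"
    and "is_arg_min (cost I) (valid_layout I) L"
    and "a \<in> sources I" and "b \<in> sources I"
    and "source_pos I a \<noteq> source_pos I b"
    and "(Source a, v\<^sub>a) \<in> edges (topo L)"
    and "(Source b, v\<^sub>b) \<in> edges (topo L)"
    and "pos L v\<^sub>a \<noteq> pos L v\<^sub>b"
    and "\<not> collinear {pos L (Source a), pos L (Source b), pos L v\<^sub>a, pos L v\<^sub>b}"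
  shows "closed_segment (pos L (Source a)) (pos L v\<^sub>a) \<inter>
         closed_segment (pos L (Source b)) (pos L v\<^sub>b) = {}"
proof (rule ccontr)
  assume "\<not> ?thesis"
  then obtain p where p: "p \<in> closed_segment (pos L (Source a)) (pos L v\<^sub>a)"
      "p \<in> closed_segment (pos L (Source b)) (pos L v\<^sub>b)"
    by blast
  let ?L' = "\<lparr>topo = relabel (Transposition.transpose a b) (topo L), pos = pos L\<rparr>"
  have valid: "valid_layout I L" and minimal: "\<And>L'. valid_layout I L' \<Longrightarrow> \<not> cost I L' < cost I L"
    using assms(2) by (auto simp: is_arg_min_def)
  have "Source a \<in> verts (topo L)" "Source b \<in> verts (topo L)"
    using valid assms(6,7)
    by (auto simp: valid_layout_def valid_topology_def topology_def rooted_forest_def)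
  \<comment> \<open>Both sources occur in the topology, so \<open>embedding\<close> equates
    \<open>pos L\<close> with their given positions.\<close>
  then have "pos L (Source a) \<noteq> pos L (Source b)"
    using valid assms(5) by (simp add: valid_layout_def embedding_def)
  then have "dist (pos L (Source a)) (pos L v\<^sub>b) + dist (pos L (Source b)) (pos L v\<^sub>a)
      < dist (pos L (Source a)) (pos L v\<^sub>a) + dist (pos L (Source b)) (pos L v\<^sub>b)"
    using crossing_segments_exchange_less[OF p] assms(8,9) by blast
  moreover have "a \<noteq> b" using assms(5) by auto
  ultimately have "cost I ?L' < cost I L"
    using cost_transpose_sources[OF valid assms(6,7,3,4)] by (simp add: dist_norm)
  moreover have "valid_layout I ?L'"
    using valid assms(3,4) by (intro valid_layout_relabel) (auto simp: Transposition.transpose_image_eq)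
  ultimately show False using minimal by blast
qed

end
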